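(* Let $n\ge0$, $0\le m\le 2^n-1$, and write $\{m\}_n=1^{k_0}0^{k_1}\cdots0^{k_{l-2}}1^{k_{l-1}}$ with $l$ odd, $k_0\ge0$, $k_i\ge1$ ($i=1,\dots,l-2$), $k_{l-1}\ge0$. Then: (1)(i) if $k_{l-1}\ge1$, then $[2^n:m]=\prod_{j=0}^{l-1}CF(k_j,k_{j+1},\dots,k_{l-1})$; (1)(ii) if $k_{l-1}=0$ and $l\ge3$, then $[2^n:m]=\prod_{j=0}^{l-3}CF(k_j,k_{j+1},\dots,k_{l-3})$; (2)(i) if $k_0\ge1$, then $[2^n:m]=\prod_{j=0}^{l-1}CF(k_j,k_{j-1},\dots,k_0)$; (2)(ii) if $k_0=0$ and $l\ge 3$, then $[2^n:m]=\prod_{j=2}^{l-1}CF(k_j,k_{j-1},\dots,k_2)$; (3)(i) $\dfrac{[2^n:m]}{[2^n:2^n-m]}=CF(k_0,k_1,\dots,k_{l-1})$; (3)(ii) $\dfrac{[2^n:m]}{[2^n:m+1]}=CF(k_{l-1},k_{l-2},\dots,k_0)$.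
   Context: Stern's diatomic integers: for integers $n\ge0$, $0\le m\le 2^n$, define $[2^0:0]=0$, $[2^0:1]=1$, $[2^{n+1}:2m]=[2^n:m]$ ($0\le m\le 2^n$), $[2^{n+1}:2m+1]=[2^n:m]+[2^n:m+1]$ ($0\le m\le 2^n-1$). $\{m\}_n$ is the length-$n$ binary word (leading zeros allowed) representing $m$; $x^k$ denotes $k$ copies of the letter $x$. Continued fractions: for integers $k_0,\dots,k_{l-1}\ge 0$ (with $k_1,\dots,k_{l-2}\ge1$), $CF(k_{l-1})=k_{l-1}$ and $CF(k_j,\dots,k_{l-1})=k_j+1/CF(k_{j+1},\dots,k_{l-1})$, computed from $j=l-2$ down to $0$, with the conventions $1/0=\infty$ and $1/\infty=0$ (so e.g. $CF(k_0,0)=\infty$, $CF(0)=0$). *)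

theory Defs
  imports Complex_Main "HOL-Library.Extended_Real"
begin

text \<open>\<open>stern n m\<close> is Stern's diatomic integer \<open>[2\<^sup>n : m]\<close>; only the values with
  \<open>m \<le> 2 ^ n\<close> are meaningful. The lemmas below are the defining recursion.\<close>

fun stern :: "nat \<Rightarrow> nat \<Rightarrow> nat" where
  "stern 0 m = (if m = 0 then 0 else 1)"
| "stern (Suc n) m =
     (if even m then stern n (m div 2) else stern n (m div 2) + stern n (m div 2 + 1))"

lemma stern_0_0: "stern 0 0 = 0"
  by simp

lemma stern_0_1: "stern 0 1 = 1"
  by simp

lemma stern_Suc_even: "stern (Suc n) (2 * m) = stern n m"
  by simp

lemma stern_Suc_odd: "stern (Suc n) (2 * m + 1) = stern n m + stern n (m + 1)"
  by simp

text \<open>Words over the alphabet \<open>{0, 1}\<close>, most significant letter first.\<close>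

fun bin_word :: "nat \<Rightarrow> nat \<Rightarrow> nat list" where
  "bin_word 0 m = []"
| "bin_word (Suc n) m = bin_word n (m div 2) @ [m mod 2]"

text \<open>The word \<open>1\<^bsup>k 0\<^esup> 0\<^bsup>k 1\<^esup> 1\<^bsup>k 2\<^esup> \<dots>\<close> with \<open>l\<close> blocks.\<close>

definition block_word :: "nat \<Rightarrow> (nat \<Rightarrow> nat) \<Rightarrow> nat list" where
  "block_word l k = concat (map (\<lambda>i. replicate (k i) (if even i then 1 else 0)) [0..<l])"

text \<open>On \<^typ>\<open>ereal\<close> division already satisfies \<open>1 / 0 = \<infinity>\<close> and \<open>1 / \<infinity> = 0\<close>.
  The value on the empty list is irrelevant and left unspecified.\<close>

fun CF :: "nat list \<Rightarrow> ereal" where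
  "CF [a] = ereal (real a)"
| "CF (a # b # ks) = ereal (real a) + 1 / CF (b # ks)"

lemma CF_conventions: "1 / (0::ereal) = \<infinity>" "1 / (\<infinity>::ereal) = 0"
  by (simp_all add: divide_ereal_def)

end

theory Submission
  imports Defs
begin

text \<open>Appending a binary digit to \<open>m\<close> changes the pair \<open>([2\<^sup>n:m], [2\<^sup>n:m+1])\<close> by adding one
  component to the other, so a block of \<open>k\<close> equal digits acts by \<open>(a, b) \<mapsto> (a + k b, b)\<close> or
  \<open>(a, b + k a)\<close>, which is the recursion of the continuants of \<open>k\<^sub>0, \<dots>, k\<^bsub>l-1\<^esub>\<close>. The pair
  \<open>([2\<^sup>n:2\<^sup>n-m], [2\<^sup>n:2\<^sup>n-1-m])\<close> obeys the same rule with starting value \<open>(1, 0)\<close> instead of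
  \<open>(0, 1)\<close>. A continued fraction is a quotient of two consecutive continuants, whence the ratios;
  the products telescope.\<close>

text \<open>The value 1 on the empty list serves as the denominator of a one-term continued
  fraction.\<close>

fun continuant :: "nat list \<Rightarrow> nat" where
  "continuant [] = 1"
| "continuant [a] = a"
| "continuant (a # b # ks) = a * continuant (b # ks) + continuant ks"

text \<open>The recursion read from the right end, which is the form that matches a word growing by
  blocks on the right.\<close>

lemma continuant_append2:
  "continuant (ks @ [a, b]) = b * continuant (ks @ [a]) + continuant ks"
  by (induction ks rule: continuant.induct) (simp_all add: algebra_simps)

text \<open>The recursions at the two ends have the same shape, so reversal merely exchanges
  them.\<close>

lemma continuant_rev: "continuant (rev ks) = continuant ks"
proof (induction ks rule: continuant.induct)
  case (3 a b ks)
  have "continuant (rev (a # b # ks)) = continuant (rev ks @ [b, a])"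
    by simp
  also have "\<dots> = a * continuant (rev (b # ks)) + continuant (rev ks)"
    by (simp only: continuant_append2 rev.simps)
  finally show ?case using 3 by simp
qed simp_all

lemma continuant_map_rev: "continuant (map k (rev xs)) = continuant (map k xs)"
  by (metis continuant_rev rev_map)

lemma continuant_pos: "(\<And>a. a \<in> set ks \<Longrightarrow> a \<ge> 1) \<Longrightarrow> continuant ks > 0"
  by (induction ks rule: continuant.induct) (auto simp: Suc_le_eq)

text \<open>Zero entries are allowed, so one of the two may vanish; excluding that both do keeps 0/0
  out of the quotients below.\<close>

lemma continuant_consecutive_nonzero: "continuant (a # ks) > 0 \<or> continuant ks > 0"
proof (induction ks arbitrary: a)
  case (Cons b ks)
  from Cons[of b] show ?case by auto
qed simp

lemma CF_eq_continuant_ratio: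
  "CF (a # ks) = ereal (real (continuant (a # ks))) / ereal (real (continuant ks))"
proof (induction ks arbitrary: a)
  case Nil
  then show ?case by simp
next
  case (Cons b ks)
  define p q where "p = continuant (b # ks)" and "q = continuant ks"
  have "p > 0 \<or> q > 0"
    unfolding p_def q_def by (rule continuant_consecutive_nonzero)
  moreover have "CF (a # b # ks) = ereal (real a) + 1 / (ereal (real p) / ereal (real q))"
    using Cons by (simp add: p_def q_def)
  \<comment> \<open>If \<open>p = 0\<close>, then \<open>q > 0\<close> and both sides are
    \<infinity>; if \<open>q = 0\<close>, then \<open>p > 0\<close>, the term
    \<open>1 / \<infinity>\<close> vanishes and both sides equal \<open>a\<close>.\<close>
  ultimately have "CF (a # b # ks) = ereal (real (a * p + q)) / ereal (real p)"
    by (cases "p = 0"; cases "q = 0") (simp_all add: divide_ereal_def field_simps)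
  then show ?case by (simp add: p_def q_def)
qed

lemma CF_mult_continuant:
  assumes "continuant ks > 0"
  shows "CF (a # ks) * ereal (real (continuant ks)) = ereal (real (continuant (a # ks)))"
  using assms by (simp add: CF_eq_continuant_ratio)

text \<open>Telescoping: the denominator of factor \<open>j\<close> is the numerator of factor
  \<open>j + 1\<close>. All denominators involve only indices strictly between \<open>a\<close> and
  \<open>b\<close>, hence are positive.\<close>

lemma prod_CF_suffixes:
  assumes "a \<le> b" "\<And>i. a < i \<Longrightarrow> i < b \<Longrightarrow> k i \<ge> 1"
  shows "(\<Prod>j = a..<b. CF (map k [j..<b])) = ereal (real (continuant (map k [a..<b])))"
  using assms
proof (induction a rule: inc_induct)
  case base
  then show ?case by simp
next
  case (step a)
  have "continuant (map k [Suc a..<b]) > 0"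
    by (rule continuant_pos) (use step.prems in auto)
  with step show ?case
    by (simp add: prod.atLeast_Suc_lessThan upt_conv_Cons CF_mult_continuant)
qed

text \<open>Telescoping from the other side: up to reversal, the denominator of each factor is the
  numerator of the preceding one, and no denominator involves the last index
  \<open>b - 1\<close>.\<close>

lemma prod_CF_rev_prefixes:
  assumes "a \<le> b" "\<And>i. a \<le> i \<Longrightarrow> Suc i < b \<Longrightarrow> k i \<ge> 1"
  shows "(\<Prod>j = a..<b. CF (map k (rev [a..<Suc j]))) = ereal (real (continuant (map k [a..<b])))"
  using assms
proof (induction b rule: dec_induct)
  case base
  then show ?case by simp
next
  case (step b)
  have "continuant (map k (rev [a..<b])) > 0"
    by (rule continuant_pos) (use step.prems in auto)
  then have "CF (map k (rev [a..<Suc b])) * ereal (real (continuant (map k (rev [a..<b]))))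
      = ereal (real (continuant (map k (rev [a..<Suc b]))))"
    using \<open>a \<le> b\<close> by (simp add: CF_mult_continuant)
  moreover have "(\<Prod>j = a..<b. CF (map k (rev [a..<Suc j])))
      = ereal (real (continuant (map k (rev [a..<b]))))"
    using step by (simp add: continuant_map_rev)
  moreover have "(\<Prod>j = a..<Suc b. CF (map k (rev [a..<Suc j])))
      = CF (map k (rev [a..<Suc b])) * (\<Prod>j = a..<b. CF (map k (rev [a..<Suc j])))"
    using \<open>a \<le> b\<close> by (subst prod.atLeastLessThan_Suc) (auto simp: mult.commute)
  ultimately show ?case
    by (metis continuant_map_rev)
qed

fun append_digit :: "nat \<times> nat \<Rightarrow> nat \<Rightarrow> nat \<times> nat" where
  "append_digit (a, b) d = (if d = 0 then (a, a + b) else (a + b, b))"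

lemma stern_pair:
  assumes "m < 2 ^ n"
  shows "foldl append_digit (0, 1) (bin_word n m) = (stern n m, stern n (m + 1))"
  using assms
proof (induction n arbitrary: m)
  case (Suc n)
  then have "m div 2 < 2 ^ n" by auto
  from Suc.IH[OF this] show ?case
    by (cases "even m") (auto simp: mod2_eq_if)
qed simp

text \<open>Appending the digit \<open>d\<close> to \<open>h\<close> appends \<open>1 - d\<close> to
  \<open>2 ^ n - 1 - h\<close>. Listing the larger argument first compensates for this flip, so
  \<open>append_digit\<close> applies unchanged.\<close>

lemma stern_complement_pair:
  assumes "m < 2 ^ n"
  shows "foldl append_digit (1, 0) (bin_word n m) = (stern n (2 ^ n - m), stern n (2 ^ n - 1 - m))"
  using assms
proof (induction n arbitrary: m)
  case (Suc n)
  define h where "h = m div 2"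
  define c where "c = 2 ^ n - 1 - h"
  have h: "h < 2 ^ n" using Suc.prems by (auto simp: h_def)
  then have c: "2 ^ n - h = c + 1" by (simp add: c_def)
  have IH: "foldl append_digit (1, 0) (bin_word n h) = (stern n (c + 1), stern n c)"
    using Suc.IH[OF h] by (simp only: c c_def)
  show ?case
  proof (cases "even m")
    case True
    then have "m = 2 * h" by (simp add: h_def)
    with h c have "2 ^ Suc n - m = 2 * (c + 1)" "2 ^ Suc n - 1 - m = 2 * c + 1"
      by auto
    with IH True show ?thesis
      by (simp add: h_def del: power_Suc)
  next
    case False
    then have "m = 2 * h + 1" by (simp add: h_def)
    with h c have "2 ^ Suc n - m = 2 * c + 1" "2 ^ Suc n - 1 - m = 2 * c"
      by auto
    with IH False show ?thesis
      by (simp add: h_def odd_iff_mod_2_eq_one del: power_Suc)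
  qed
qed simp

lemma foldl_append_digit_replicate:
  "foldl append_digit (a, b) (replicate k d) = (if d = 0 then (a, b + k * a) else (a + k * b, b))"
  by (induction k arbitrary: a b; cases "d = 0") simp_all

lemma foldl_block_word_Suc:
  assumes "foldl append_digit p (block_word l k) = (a, b)"
  shows "foldl append_digit p (block_word (Suc l) k)
    = (if even l then (a + k l * b, b) else (a, b + k l * a))"
  using assms by (simp add: block_word_def foldl_append_digit_replicate)

text \<open>A block of ones changes the first component and a block of zeros the second, so the
  parity of \<open>l\<close> decides where the newest continuant sits.\<close>

lemma foldl_block_word:
  "foldl append_digit (0, 1) (block_word (Suc l) k) =
    (if even l then (continuant (map k [0..<Suc l]), continuant (map k [0..<l]))
     else (continuant (map k [0..<l]), continuant (map k [0..<Suc l])))"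
proof (induction l)
  case 0
  show ?case by (simp add: block_word_def foldl_append_digit_replicate)
next
  case (Suc l)
  have "continuant (map k [0..<Suc (Suc l)])
      = k (Suc l) * continuant (map k [0..<Suc l]) + continuant (map k [0..<l])"
    using continuant_append2[of "map k [0..<l]" "k l" "k (Suc l)"] by simp
  with Suc show ?case
    by (cases "even l") (simp_all only: foldl_block_word_Suc if_True if_False even_Suc
        not_True_eq_False not_False_eq_True, simp_all)
qed

text \<open>The initial block of ones fixes \<open>(1, 0)\<close>, so the continuants start at index
  1. Two blocks are the base case: only then has the component 0 become the continuant
  \<open>k 1\<close>.\<close>

lemma foldl_block_word_complement:
  "foldl append_digit (1, 0) (block_word (Suc (Suc l)) k) =
    (if even l then (continuant (map k [1..<Suc l]), continuant (map k [1..<Suc (Suc l)]))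
     else (continuant (map k [1..<Suc (Suc l)]), continuant (map k [1..<Suc l])))"
proof (induction l)
  case 0
  show ?case by (simp add: block_word_def foldl_append_digit_replicate)
next
  case (Suc l)
  have "continuant (map k [1..<Suc (Suc (Suc l))])
      = k (Suc (Suc l)) * continuant (map k [1..<Suc (Suc l)]) + continuant (map k [1..<Suc l])"
    using continuant_append2[of "map k [1..<Suc l]" "k (Suc l)" "k (Suc (Suc l))"] by simp
  with Suc show ?case
    by (cases "even l") (simp_all only: foldl_block_word_Suc if_True if_False even_Suc
        not_True_eq_False not_False_eq_True, simp_all)
qed

theorem theorem4p9:
  fixes n m l :: nat and k :: "nat \<Rightarrow> nat"
  assumes "m \<le> 2 ^ n - 1"
    and "odd l"
    and "\<And>i. i \<in> {1..l - 2} \<Longrightarrow> k i \<ge> 1"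
    and "bin_word n m = block_word l k"
  shows
    "(k (l - 1) \<ge> 1 \<longrightarrow>
        ereal (real (stern n m)) = (\<Prod>j = 0..l - 1. CF (map k [j..<l]))) \<and>
     (k (l - 1) = 0 \<and> l \<ge> 3 \<longrightarrow>
        ereal (real (stern n m)) = (\<Prod>j = 0..l - 3. CF (map k [j..<l - 2]))) \<and>
     (k 0 \<ge> 1 \<longrightarrow>
        ereal (real (stern n m)) = (\<Prod>j = 0..l - 1. CF (map k (rev [0..<Suc j])))) \<and>
     (k 0 = 0 \<and> l \<ge> 3 \<longrightarrow>
        ereal (real (stern n m)) = (\<Prod>j = 2..l - 1. CF (map k (rev [2..<Suc j])))) \<and>
     ereal (real (stern n m)) / ereal (real (stern n (2 ^ n - m))) = CF (map k [0..<l]) \<and>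
     ereal (real (stern n m)) / ereal (real (stern n (m + 1))) = CF (map k (rev [0..<l]))"
proof -
  have m: "m < 2 ^ n"
    using assms(1) by (metis One_nat_def Suc_pred le_imp_less_Suc pos2 zero_less_power)
  obtain r where l: "l = Suc r" and r: "even r"
    using \<open>odd l\<close> by (cases l) auto
  have pair: "stern n m = continuant (map k [0..<l])" "stern n (m + 1) = continuant (map k [0..<r])"
    using stern_pair[OF m] foldl_block_word[of r k] assms(4) r by (simp_all add: l)
  have compl: "stern n (2 ^ n - m) = continuant (map k [1..<l])"
  proof (cases r)
    \<comment> \<open>A single block of ones leaves the first component at 1, the empty
      continuant.\<close>
    case 0
    then show ?thesis
      using stern_complement_pair[OF m] assms(4)
      by (simp add: l block_word_def foldl_append_digit_replicate)
  next
    case (Suc s)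
    then show ?thesis
      using stern_complement_pair[OF m] foldl_block_word_complement[of s k] assms(4) r
      by (simp add: l)
  qed
  have inner: "k i \<ge> 1" if "0 < i" "i < r" for i
    using assms(3)[of i] that by (simp add: l)
  have to_l: "{a..l - 1} = {a..<l}" for a
    by (auto simp: l)
  have 1: "ereal (real (stern n m)) = (\<Prod>j = 0..l - 1. CF (map k [j..<l]))" if "k (l - 1) \<ge> 1"
  proof -
    have "k i \<ge> 1" if "0 < i" "i < l" for i
      using inner[of i] \<open>k (l - 1) \<ge> 1\<close> that by (cases "i = r") (auto simp: l)
    then show ?thesis
      unfolding to_l pair by (subst prod_CF_suffixes) auto
  qed
  have 2: "ereal (real (stern n m)) = (\<Prod>j = 0..l - 3. CF (map k [j..<l - 2]))"
    if "k (l - 1) = 0" "l \<ge> 3"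
  proof -
    obtain s where s: "l = Suc (Suc s)" and "s > 0"
      using \<open>l \<ge> 3\<close> by (metis Suc_le_D Suc_le_mono numeral_3_eq_3 zero_less_Suc)
    have "{0..l - 3} = {0..<l - 2}"
      using s \<open>s > 0\<close> by auto
    \<comment> \<open>A final entry 0 kills the leading term of the right-end recursion, so the last
      two entries drop out.\<close>
    moreover have "continuant (map k [0..<l]) = continuant (map k [0..<l - 2])"
      using continuant_append2[of "map k [0..<s]" "k s" "k (Suc s)"] that by (simp add: s)
    moreover have "k i \<ge> 1" if "0 < i" "i < l - 2" for i
      using inner[of i] that by (simp add: l)
    ultimately show ?thesis
      unfolding pair by (simp only:) (subst prod_CF_suffixes, auto)
  qed
  have 3: "ereal (real (stern n m)) = (\<Prod>j = 0..l - 1. CF (map k (rev [0..<Suc j])))"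
    if "k 0 \<ge> 1"
  proof -
    have "k i \<ge> 1" if "Suc i < l" for i
      using inner[of i] \<open>k 0 \<ge> 1\<close> that by (cases "i = 0") (auto simp: l)
    then show ?thesis
      unfolding to_l pair by (subst prod_CF_rev_prefixes) auto
  qed
  have 4: "ereal (real (stern n m)) = (\<Prod>j = 2..l - 1. CF (map k (rev [2..<Suc j])))"
    if "k 0 = 0" "l \<ge> 3"
  proof -
    \<comment> \<open>Likewise, \<open>k 0 = 0\<close> removes the first two entries through the
      left-end recursion.\<close>
    have "[0..<l] = 0 # 1 # [2..<l]"
      using \<open>l \<ge> 3\<close> by (simp add: upt_conv_Cons numeral_2_eq_2)
    then have "continuant (map k [0..<l]) = continuant (map k [2..<l])"
      using \<open>k 0 = 0\<close> by simp
    moreover have "k i \<ge> 1" if "2 \<le> i" "Suc i < l" for i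
      using inner[of i] that by (simp add: l)
    ultimately show ?thesis
      unfolding to_l pair using \<open>l \<ge> 3\<close> by (subst prod_CF_rev_prefixes) auto
  qed
  have 5: "ereal (real (stern n m)) / ereal (real (stern n (2 ^ n - m))) = CF (map k [0..<l])"
  proof -
    have "map k [0..<l] = k 0 # map k [1..<l]"
      by (simp add: l upt_conv_Cons del: upt_Suc)
    then show ?thesis
      by (simp only: pair compl CF_eq_continuant_ratio)
  qed
  have 6: "ereal (real (stern n m)) / ereal (real (stern n (m + 1))) = CF (map k (rev [0..<l]))"
  proof -
    \<comment> \<open>Reversal puts the last block at the head, so the denominator becomes the
      continuant of the first \<open>r\<close> entries, which is
      \<open>stern n (m + 1)\<close>.\<close>
    have "map k (rev [0..<l]) = k r # map k (rev [0..<r])"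
      by (simp add: l)
    then show ?thesis
      by (metis pair CF_eq_continuant_ratio continuant_map_rev)
  qed
  from 1 2 3 4 5 6 show ?thesis by blast
qed

end
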